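(* Let $f\in\mathbb{C}[\mathbf{x}]=\mathbb{C}[x_1,\dots,x_n]$ be a non-zero polynomial, $p\in\mathbb{C}^n$ and $\alpha\in\mathbb{Q}$. Let $\{P_1(s),\dots,P_k(s)\}$ be a system of generators of the left ideal $\operatorname{Ann}_{D[s]}(f^s)$ of $D[s]$, and consider the left ideal $I=D[s]\langle P_1(s),\dots,P_k(s),f,s+\alpha\rangle$. Then $$(s+\alpha)\mid b_{f,p}(s)\iff p\in V(I\cap\mathbb{C}[\mathbf{x}]),$$ where $b_{f,p}(s)$ is the local $b$-function of $f$ at $p$.
   Context: $D$ is the $n$-th Weyl algebra over $\mathbb{C}$, generated by $x_1,\dots,x_n,\partial_1,\dots,\partial_n$ with relations $\partial_i x_j=x_j\partial_i+\delta_{ij}$, $x_jx_i=x_ix_j$, $\partial_j\partial_i=\partial_i\partial_j$; $D[s]=D\otimes_{\mathbb{C}}\mathbb{C}[s]$. $D[s]\langle\dots\rangle$ is the left ideal generated by the listed elements. $\mathbb{C}[\mathbf{x}][s,\frac1f]\cdot f^s$ is the free module of rank one on the symbol $f^s$, a left $D[s]$-module via $\partial_i(g\cdot f^s)=\big(\frac{\partial g}{\partial x_i}+s\,g\,\frac{\partial f}{\partial x_i}\frac1f\big)\cdot f^s$, and $\operatorname{Ann}_{D[s]}(f^s)$ is the left ideal of all $P(s)\in D[s]$ with $P(s)\cdot f^s=0$. $V(\mathfrak{a})\subseteq\mathbb{C}^n$ is the zero set of an ideal $\mathfrak{a}\subseteq\mathbb{C}[\mathbf{x}]$. For $p\in\mathbb{C}^n$,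 $\mathfrak{m}_p=\langle x_1-p_1,\dots,x_n-p_n\rangle$, $\mathbb{C}[\mathbf{x}]_p$ is the localization of $\mathbb{C}[\mathbf{x}]$ at $\mathfrak{m}_p$, and $D_p$ is the local Weyl algebra at $p$, i.e. the Weyl algebra with coefficients in $\mathbb{C}[\mathbf{x}]_p$ instead of $\mathbb{C}[\mathbf{x}]$ (equivalently $(\mathbb{C}[\mathbf{x}]\setminus\mathfrak{m}_p)^{-1}D$); $D_p[s]=D_p\otimes_{\mathbb{C}}\mathbb{C}[s]$ acts on $\mathbb{C}[\mathbf{x}]_p[s,\frac1f]\cdot f^s$ by the same formula. The local $b$-function (local Bernstein-Sato polynomial) $b_{f,p}(s)\in\mathbb{C}[s]$ is the monic polynomial of minimal degree for which there exists $P_p(s)\in D_p[s]$ with $P_p(s)f\cdot f^s=b_{f,p}(s)\cdot f^s$. *)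

theory Defs
  imports
    "HOL-Analysis.Finite_Cartesian_Product"
    "HOL-Library.Poly_Mapping"
    "HOL-Computational_Algebra.Polynomial"
    "HOL-Computational_Algebra.Fraction_Field"
begin

section \<open>Polynomials and rational functions in the variables indexed by a finite type\<close>

text \<open>
  The index type carries a linear order because \<^theory>\<open>HOL-Library.Poly_Mapping\<close> needs one for the
  \<^class>\<open>idom\<close> instance on which the fraction field depends.
\<close>

abbreviation "keys \<equiv> Poly_Mapping.keys"
abbreviation "lookup \<equiv> Poly_Mapping.lookup"

type_synonym 'n mpoly = "('n \<Rightarrow>\<^sub>0 nat) \<Rightarrow>\<^sub>0 complex"
type_synonym 'n ratfun = "'n mpoly fract"

definition mp_eval :: "'n mpoly \<Rightarrow> complex ^ 'n \<Rightarrow> complex"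
  where "mp_eval g p = (\<Sum>m\<in>keys g. lookup g m * (\<Prod>i\<in>UNIV. (p $ i) ^ lookup m i))"

text \<open>The truncated exponent \<open>m - e\<^sub>i\<close> for \<open>m\<^sub>i = 0\<close> is harmless: its coefficient is zero.\<close>

definition mp_deriv :: "'n \<Rightarrow> 'n mpoly \<Rightarrow> 'n mpoly"
  where "mp_deriv i g =
    (\<Sum>m\<in>keys g. Poly_Mapping.single (m - Poly_Mapping.single i 1) (of_nat (lookup m i) * lookup g m))"

lemma poly_mapping_additive_induct [case_names zero single add]:
  assumes "P 0" "\<And>m a. P (Poly_Mapping.single m a)" "\<And>g h. P g \<Longrightarrow> P h \<Longrightarrow> P (g + h)"
  shows "P (g :: 'a \<Rightarrow>\<^sub>0 'b::comm_monoid_add)"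
proof -
  have eq: "g = (\<Sum>m\<in>keys g. Poly_Mapping.single m (lookup g m))"
    by (rule poly_mapping_eqI) (auto simp: lookup_sum lookup_single when_def in_keys_iff)
  have "P (\<Sum>m\<in>A. Poly_Mapping.single m (lookup g m))" if "finite A" for A
    using that by (induction A rule: finite_induct) (auto intro: assms)
  then show ?thesis
    by (subst eq) simp
qed

lemma keys_sum_superset:
  assumes "finite A" "keys g \<subseteq> A" "\<And>k. F k 0 = 0"
  shows "(\<Sum>k\<in>keys g. F k (lookup g k)) = (\<Sum>k\<in>A. F k (lookup g k))"
  using assms by (intro sum.mono_neutral_left) (auto simp: in_keys_iff)

lemma keys_sum_add:
  fixes F :: "'a \<Rightarrow> 'b::comm_monoid_add \<Rightarrow> 'c::comm_monoid_add"
  assumes "\<And>k. F k 0 = 0" "\<And>k a b. F k (a + b) = F k a + F k b"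
  shows "(\<Sum>k\<in>keys (g + h). F k (lookup (g + h) k))
    = (\<Sum>k\<in>keys g. F k (lookup g k)) + (\<Sum>k\<in>keys h. F k (lookup h k))"
proof -
  let ?A = "keys g \<union> keys h"
  have "(\<Sum>k\<in>keys (g + h). F k (lookup (g + h) k)) = (\<Sum>k\<in>?A. F k (lookup (g + h) k))"
    using assms keys_add[of g h] by (intro keys_sum_superset) auto
  also have "\<dots> = (\<Sum>k\<in>?A. F k (lookup g k)) + (\<Sum>k\<in>?A. F k (lookup h k))"
    by (simp add: lookup_add assms sum.distrib)
  also have "\<dots> = (\<Sum>k\<in>keys g. F k (lookup g k)) + (\<Sum>k\<in>keys h. F k (lookup h k))"
    using assms keys_sum_superset[of ?A g F] keys_sum_superset[of ?A h F] by simp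
  finally show ?thesis .
qed

lemma mp_deriv_add: "mp_deriv i (g + h) = mp_deriv i g + mp_deriv i h"
  unfolding mp_deriv_def
  by (rule keys_sum_add[where F = "\<lambda>m c. Poly_Mapping.single (m - Poly_Mapping.single i 1) (of_nat (lookup m i) * c)"])
     (auto simp: distrib_left single_add)

lemma mp_deriv_0 [simp]: "mp_deriv i 0 = 0"
  by (simp add: mp_deriv_def)

lemma mp_deriv_single:
  "mp_deriv i (Poly_Mapping.single m c)
    = Poly_Mapping.single (m - Poly_Mapping.single i 1) (of_nat (lookup m i) * c)"
  by (simp add: mp_deriv_def)

lemma mp_deriv_const [simp]: "mp_deriv i (Poly_Mapping.single 0 c) = 0"
  by (simp add: mp_deriv_single)

lemma mp_deriv_1 [simp]: "mp_deriv i 1 = 0"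
  using mp_deriv_const[of i 1] by simp

lemma mp_deriv_mult: "mp_deriv i (g * h) = mp_deriv i g * h + g * mp_deriv i h"
proof (induction g rule: poly_mapping_additive_induct)
  case (single m a)
  show ?case
  proof (induction h rule: poly_mapping_additive_induct)
    case (single k b)
    have shift: "Poly_Mapping.single (m - Poly_Mapping.single i 1 + k) (of_nat (lookup m i) * c)
        = Poly_Mapping.single (m + k - Poly_Mapping.single i 1) (of_nat (lookup m i) * c)"
      for m k :: "'a \<Rightarrow>\<^sub>0 nat" and c :: complex
    proof (cases "lookup m i = 0")
      case False
      then have "m - Poly_Mapping.single i 1 + k = m + k - Poly_Mapping.single i 1"
        by (intro poly_mapping_eqI) (auto simp: lookup_add lookup_minus lookup_single when_def)
      then show ?thesis by simp
    qed simp
    show ?case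
      using shift[of m k "a * b"] shift[of k m "a * b"]
      by (simp add: mult_single mp_deriv_single lookup_add algebra_simps flip: single_add)
  qed (simp_all add: mp_deriv_add algebra_simps)
qed (simp_all add: mp_deriv_add algebra_simps)

lemma mp_deriv_commute: "mp_deriv i (mp_deriv j g) = mp_deriv j (mp_deriv i g)"
proof (induction g rule: poly_mapping_additive_induct)
  case (single m a)
  show ?case
  proof (cases "i = j")
    case False
    then have "m - Poly_Mapping.single j 1 - Poly_Mapping.single i 1
        = m - Poly_Mapping.single i 1 - Poly_Mapping.single j 1"
      by (intro poly_mapping_eqI) (simp add: lookup_minus)
    with False show ?thesis
      by (simp add: mp_deriv_single lookup_minus lookup_single mult.left_commute)
  qed simp
qed (simp_all add: mp_deriv_add)

lemma mp_deriv_uminus: "mp_deriv i (- g) = - mp_deriv i g"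
  using mp_deriv_add[of i g "- g"] by (simp add: eq_neg_iff_add_eq_0 add.commute)

lemma mp_deriv_diff: "mp_deriv i (g - h) = mp_deriv i g - mp_deriv i h"
  using mp_deriv_add[of i g "- h"] by (simp add: mp_deriv_uminus)

lemma quotient_rule_cong:
  fixes a b a' b' da db da' db' :: "'a::comm_ring_1"
  assumes eq: "a * b' = a' * b" and deq: "da * b' + a * db' = da' * b + a' * db"
  shows "(da * b - a * db) * (b' * b') = (da' * b' - a' * db') * (b * b)"
proof -
  have "da * b' = da' * b + a' * db - a * db'"
    using deq by (metis add_diff_cancel_right')
  then have "(da * b') * (b * b') = (da' * b + a' * db - a * db') * (b * b')"
    by simp
  also have "\<dots> = da' * b * b * b' + (a' * b) * db * b' - (a * b') * db' * b"
    by (simp add: algebra_simps)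
  also have "\<dots> = da' * b * b * b' + (a * b') * db * b' - (a' * b) * db' * b"
    by (simp add: eq)
  finally show ?thesis
    by (simp add: algebra_simps)
qed

lift_definition rf_deriv :: "'n::{finite,linorder} \<Rightarrow> 'n ratfun \<Rightarrow> 'n ratfun"
  is "\<lambda>i (a, b). (mp_deriv i a * b - a * mp_deriv i b, b * b)"
proof -
  fix i :: 'n and q r :: "'n mpoly \<times> 'n mpoly"
  obtain a b a' b' where qr: "q = (a, b)" "r = (a', b')"
    by (cases q, cases r) blast
  assume "fractrel q r"
  then have nz: "b \<noteq> 0" "b' \<noteq> 0" and eq: "a * b' = a' * b"
    by (simp_all only: qr fractrel_iff fst_conv snd_conv simp_thms)
  have "mp_deriv i a * b' + a * mp_deriv i b' = mp_deriv i a' * b + a' * mp_deriv i b"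
    using arg_cong[OF eq, of "mp_deriv i"] by (simp only: mp_deriv_mult)
  from quotient_rule_cong[OF eq this] nz
  show "fractrel (case q of (a, b) \<Rightarrow> (mp_deriv i a * b - a * mp_deriv i b, b * b))
      (case r of (a, b) \<Rightarrow> (mp_deriv i a * b - a * mp_deriv i b, b * b))"
    by (simp only: qr fractrel_iff prod.case fst_conv snd_conv mult_eq_0_iff) simp
qed

lemma rf_deriv_Fract:
  assumes "b \<noteq> 0"
  shows "rf_deriv i (Fract a b) = Fract (mp_deriv i a * b - a * mp_deriv i b) (b * b)"
proof -
  have *: "b * b \<noteq> 0" "fractrel (a, b) (a, b)"
    using assms by (simp_all only: mult_eq_0_iff simp_thms fractrel_iff snd_conv)
  show ?thesis
    using assms * by (simp only: Fract.abs_eq rf_deriv.abs_eq prod.case if_False simp_thms)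
qed

definition rf_of_mp :: "'n::{finite,linorder} mpoly \<Rightarrow> 'n ratfun"
  where "rf_of_mp g = Fract g 1"

definition rf_const :: "complex \<Rightarrow> 'n::{finite,linorder} ratfun"
  where "rf_const c = rf_of_mp (Poly_Mapping.single 0 c)"

definition rf_var :: "'n::{finite,linorder} \<Rightarrow> 'n ratfun"
  where "rf_var i = rf_of_mp (Poly_Mapping.single (Poly_Mapping.single i 1) 1)"

lemma rf_deriv_of_mp: "rf_deriv i (rf_of_mp g) = rf_of_mp (mp_deriv i g)"
  by (simp add: rf_of_mp_def rf_deriv_Fract)

lemma rf_deriv_0 [simp]: "rf_deriv i 0 = 0"
  using rf_deriv_of_mp[of i 0] by (simp add: rf_of_mp_def flip: Zero_fract_def)

lemma rf_deriv_const [simp]: "rf_deriv i (rf_const c) = 0"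
  by (simp add: rf_const_def rf_deriv_of_mp) (simp add: rf_of_mp_def flip: Zero_fract_def)

lemma rf_deriv_1 [simp]: "rf_deriv i 1 = 0"
  using rf_deriv_const[of i 1] by (simp add: rf_const_def rf_of_mp_def flip: One_fract_def)

lemma quotient_rule_add:
  fixes a b c d a' b' c' d' :: "'a::idom"
  assumes "b \<noteq> 0" "d \<noteq> 0"
  shows "Fract ((a' * d + a * d' + (c' * b + c * b')) * (b * d) - (a * d + c * b) * (b' * d + b * d')) (b * d * (b * d))
    = Fract (a' * b - a * b') (b * b) + Fract (c' * d - c * d') (d * d)"
  using assms by (simp add: eq_fract) (simp add: algebra_simps)

lemma quotient_rule_mult:
  fixes a b c d a' b' c' d' :: "'a::idom"
  assumes "b \<noteq> 0" "d \<noteq> 0"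
  shows "Fract ((a' * c + a * c') * (b * d) - a * c * (b' * d + b * d')) (b * d * (b * d))
    = Fract (a' * b - a * b') (b * b) * Fract c d + Fract a b * Fract (c' * d - c * d') (d * d)"
  using assms by (simp add: eq_fract) (simp add: algebra_simps)

lemma quotient_rule_commute:
  fixes a b a1 a2 a12 b1 b2 b12 :: "'a::idom"
  assumes "b \<noteq> 0"
  shows "Fract ((a12 * b + a2 * b1 - (a1 * b2 + a * b12)) * (b * b) - (a2 * b - a * b2) * (b1 * b + b * b1)) (b * b * (b * b))
    = Fract ((a12 * b + a1 * b2 - (a2 * b1 + a * b12)) * (b * b) - (a1 * b - a * b1) * (b2 * b + b * b2)) (b * b * (b * b))"
  using assms by (simp add: eq_fract) (simp add: algebra_simps)

lemma rf_deriv_add: "rf_deriv i (q + r) = rf_deriv i q + rf_deriv i r"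
proof (cases q; cases r)
  fix a b c d assume *: "q = Fract a b" "b \<noteq> 0" "r = Fract c d" "d \<noteq> 0"
  then have "b * d \<noteq> 0" by (simp only: mult_eq_0_iff simp_thms)
  with * show ?thesis
    by (simp only: simp_thms add_fract rf_deriv_Fract mp_deriv_add mp_deriv_mult quotient_rule_add)
qed

lemma rf_deriv_mult: "rf_deriv i (q * r) = rf_deriv i q * r + q * rf_deriv i r"
proof (cases q; cases r)
  fix a b c d assume *: "q = Fract a b" "b \<noteq> 0" "r = Fract c d" "d \<noteq> 0"
  then have "b * d \<noteq> 0" by (simp only: mult_eq_0_iff simp_thms)
  with *(2,4) show ?thesis
    unfolding *(1,3) mult_fract[of a b c d]
    by (simp only: simp_thms rf_deriv_Fract mp_deriv_mult quotient_rule_mult)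
qed

lemma rf_deriv_commute: "rf_deriv i (rf_deriv j q) = rf_deriv j (rf_deriv i q)"
proof (cases q)
  fix a b assume *: "q = Fract a b" "b \<noteq> 0"
  then have "b * b \<noteq> 0" by (simp only: mult_eq_0_iff simp_thms)
  with * show ?thesis
    by (simp only: simp_thms rf_deriv_Fract mp_deriv_mult mp_deriv_diff mp_deriv_commute[of i j]
        quotient_rule_commute[of b "mp_deriv j (mp_deriv i a)" "mp_deriv j a" "mp_deriv i b"
          "mp_deriv i a" "mp_deriv j b" a "mp_deriv j (mp_deriv i b)"])
qed

lemma rf_deriv_var: "rf_deriv i (rf_var j) = (if i = j then 1 else 0)"
  by (auto simp: rf_var_def rf_deriv_of_mp mp_deriv_single lookup_single)
     (simp_all add: rf_of_mp_def flip: Zero_fract_def One_fract_def)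

text \<open>The local ring of \<open>\<complex>\<^sup>n\<close> at \<open>p\<close>, as a subring of the field of rational functions.\<close>

definition local_ring :: "complex ^ ('n::{finite,linorder}) \<Rightarrow> 'n ratfun set"
  where "local_ring p = {Fract g h | g h. mp_eval h p \<noteq> 0}"

definition zero_set :: "'n mpoly set \<Rightarrow> (complex ^ 'n) set"
  where "zero_set \<aa> = {p. \<forall>g\<in>\<aa>. mp_eval g p = 0}"


section \<open>Coefficients: polynomials in the central variable s over the rational functions\<close>

definition sderiv :: "'n::{finite,linorder} \<Rightarrow> 'n ratfun poly \<Rightarrow> 'n ratfun poly"
  where "sderiv i = map_poly (rf_deriv i)"

definition of_cs :: "complex poly \<Rightarrow> 'n::{finite,linorder} ratfun poly"
  where "of_cs = map_poly rf_const"

definition of_cx :: "'n::{finite,linorder} mpoly \<Rightarrow> 'n ratfun poly"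
  where "of_cx g = [:rf_of_mp g:]"

lemma coeff_sderiv: "coeff (sderiv i c) j = rf_deriv i (coeff c j)"
  by (simp add: sderiv_def coeff_map_poly)

lemma sderiv_0 [simp]: "sderiv i 0 = 0"
  by (simp add: sderiv_def)

lemma sderiv_1 [simp]: "sderiv i 1 = 0"
  by (simp add: poly_eq_iff coeff_sderiv)

lemma sderiv_add: "sderiv i (c + d) = sderiv i c + sderiv i d"
  by (simp add: poly_eq_iff coeff_sderiv rf_deriv_add)

lemma rf_deriv_sum: "rf_deriv i (\<Sum>k\<in>A. F k) = (\<Sum>k\<in>A. rf_deriv i (F k))"
  by (induction A rule: infinite_finite_induct) (simp_all add: rf_deriv_add)

lemma sderiv_mult: "sderiv i (c * d) = sderiv i c * d + c * sderiv i d"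
  by (simp add: poly_eq_iff coeff_sderiv coeff_mult rf_deriv_sum rf_deriv_mult sum.distrib)

lemma sderiv_commute: "sderiv i (sderiv j c) = sderiv j (sderiv i c)"
  by (simp add: poly_eq_iff coeff_sderiv rf_deriv_commute)


section \<open>Weyl algebras\<close>

text \<open>
  All Weyl algebras considered here are subrings of the Weyl algebra with coefficients in the
  field of rational functions, with a central variable \<open>s\<close> adjoined. An operator is stored in its
  unique normal form \<open>\<Sum>\<^sub>\<beta> c\<^sub>\<beta> \<partial>\<^sup>\<beta>\<close>, where the coefficients \<open>c\<^sub>\<beta>\<close> are polynomials in \<open>s\<close> over the
  rational functions.
\<close>

typedef (overloaded) 'n weyl = "UNIV :: (('n::{finite,linorder} \<Rightarrow>\<^sub>0 nat) \<Rightarrow>\<^sub>0 'n ratfun poly) set"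
  morphisms wcoeffs Weyl
  by simp

setup_lifting type_definition_weyl

text \<open>The composite \<open>T\<^sup>\<beta>\<close>; the order of the factors is immaterial, as the \<open>T\<^sub>i\<close> will commute.\<close>

definition multi_pow :: "('n::{finite,linorder} \<Rightarrow> 'a \<Rightarrow> 'a) \<Rightarrow> ('n \<Rightarrow>\<^sub>0 nat) \<Rightarrow> 'a \<Rightarrow> 'a"
  where "multi_pow T \<beta> = foldr (\<lambda>i. T i ^^ lookup \<beta> i) (sorted_list_of_set UNIV)"

text \<open>
  Left multiplication by \<open>\<partial>\<^sub>i\<close> on normal forms. It is dictated by \<open>\<partial>\<^sub>i c = c \<partial>\<^sub>i + \<partial>c/\<partial>x\<^sub>i\<close>:
  \<open>\<partial>\<^sub>i (\<Sum> c\<^sub>\<beta> \<partial>\<^sup>\<beta>) = \<Sum> (\<partial>c\<^sub>\<beta>/\<partial>x\<^sub>i) \<partial>\<^sup>\<beta> + \<Sum> c\<^sub>\<beta> \<partial>\<^sup>\<beta>\<^sup>+\<^sup>e\<^sup>i\<close>. The products on the right hand sides of this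
  definition and the next are those of \<^theory>\<open>HOL-Library.Poly_Mapping\<close>; they only shift exponents
  and multiply all coefficients by \<open>c\<close>, respectively.
\<close>

definition left_d ::
  "'n::{finite,linorder} \<Rightarrow> (('n \<Rightarrow>\<^sub>0 nat) \<Rightarrow>\<^sub>0 'n ratfun poly) \<Rightarrow> (('n \<Rightarrow>\<^sub>0 nat) \<Rightarrow>\<^sub>0 'n ratfun poly)"
  where "left_d i Q =
    Poly_Mapping.map (sderiv i) Q + Poly_Mapping.single (Poly_Mapping.single i 1) 1 * Q"

definition left_c ::
  "'n::{finite,linorder} ratfun poly \<Rightarrow> (('n \<Rightarrow>\<^sub>0 nat) \<Rightarrow>\<^sub>0 'n ratfun poly) \<Rightarrow> (('n \<Rightarrow>\<^sub>0 nat) \<Rightarrow>\<^sub>0 'n ratfun poly)"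
  where "left_c c Q = Poly_Mapping.single 0 c * Q"

text \<open>
  A module over the coefficients with commuting operators satisfying the Leibniz rule is a left
  module over the Weyl algebra. Taking for it the Weyl algebra itself yields the multiplication.
\<close>

definition op_apply ::
  "('n::{finite,linorder} ratfun poly \<Rightarrow> 'm::ab_group_add \<Rightarrow> 'm) \<Rightarrow> ('n \<Rightarrow> 'm \<Rightarrow> 'm)
    \<Rightarrow> (('n \<Rightarrow>\<^sub>0 nat) \<Rightarrow>\<^sub>0 'n ratfun poly) \<Rightarrow> 'm \<Rightarrow> 'm"
  where "op_apply scal nabla P u = (\<Sum>\<beta>\<in>keys P. scal (lookup P \<beta>) (multi_pow nabla \<beta> u))"

locale diff_module = module scal
  for scal :: "'n::{finite,linorder} ratfun poly \<Rightarrow> 'm::ab_group_add \<Rightarrow> 'm" +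
  fixes nabla :: "'n \<Rightarrow> 'm \<Rightarrow> 'm"
  assumes nabla_add: "nabla i (u + v) = nabla i u + nabla i v"
    and nabla_commute: "nabla i (nabla j u) = nabla j (nabla i u)"
    and nabla_scal: "nabla i (scal c u) = scal (sderiv i c) u + scal c (nabla i u)"
begin

abbreviation app where "app \<equiv> op_apply scal nabla"

lemma nabla_pow_commute: "nabla i ((nabla j ^^ k) u) = (nabla j ^^ k) (nabla i u)"
  by (induction k) (simp_all add: nabla_commute[of i j])

lemma nabla_multi_pow: "nabla i (multi_pow nabla \<beta> u) = multi_pow nabla (\<beta> + Poly_Mapping.single i 1) u"
proof -
  let ?g = "\<lambda>\<beta> j. nabla j ^^ lookup \<beta> j"
  let ?\<beta> = "\<beta> + Poly_Mapping.single i 1"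
  have notin: "foldr (?g ?\<beta>) xs u = foldr (?g \<beta>) xs u" if "i \<notin> set xs" for xs
    using that by (induction xs) (auto simp: lookup_add lookup_single when_def)
  have "nabla i (foldr (?g \<beta>) xs u) = foldr (?g ?\<beta>) xs u" if "i \<in> set xs" "distinct xs" for xs
    using that
  proof (induction xs)
    case (Cons j xs)
    show ?case
    proof (cases "j = i")
      case True
      with Cons.prems notin[of xs] show ?thesis by (simp add: lookup_add)
    next
      case False
      with Cons show ?thesis
        by (simp add: nabla_pow_commute lookup_add lookup_single when_def)
    qed
  qed simp
  then show ?thesis by (simp add: multi_pow_def)
qed

lemma nabla_0 [simp]: "nabla i 0 = 0"
  using nabla_add[of i 0 0] by simp

lemma nabla_sum: "nabla i (\<Sum>k\<in>A. F k) = (\<Sum>k\<in>A. nabla i (F k))"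
  by (induction A rule: infinite_finite_induct) (simp_all add: nabla_add)

lemma nabla_pow_add: "(nabla i ^^ k) (u + v) = (nabla i ^^ k) u + (nabla i ^^ k) v"
  by (induction k) (simp_all add: nabla_add)

lemma multi_pow_add: "multi_pow nabla \<beta> (u + v) = multi_pow nabla \<beta> u + multi_pow nabla \<beta> v"
proof -
  have "foldr (\<lambda>j. nabla j ^^ lookup \<beta> j) xs (u + v)
      = foldr (\<lambda>j. nabla j ^^ lookup \<beta> j) xs u + foldr (\<lambda>j. nabla j ^^ lookup \<beta> j) xs v" for xs
    by (induction xs) (simp_all add: nabla_pow_add)
  then show ?thesis by (simp add: multi_pow_def)
qed

lemma multi_pow_0 [simp]: "multi_pow nabla 0 u = u"
proof -
  have "foldr (\<lambda>j. nabla j ^^ lookup 0 j) xs u = u" for xs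
    by (induction xs) simp_all
  then show ?thesis by (simp add: multi_pow_def)
qed

lemma app_add_left: "app (P + Q) u = app P u + app Q u"
  unfolding op_apply_def
  by (rule keys_sum_add[where F = "\<lambda>\<beta> c. scal c (multi_pow nabla \<beta> u)"])
     (simp_all add: scale_left_distrib)

lemma app_add_right: "app P (u + v) = app P u + app P v"
  by (simp add: op_apply_def multi_pow_add scale_right_distrib sum.distrib)

lemma app_0_left [simp]: "app 0 u = 0"
  by (simp add: op_apply_def)

lemma app_single: "app (Poly_Mapping.single \<beta> c) u = scal c (multi_pow nabla \<beta> u)"
  by (simp add: op_apply_def)

lemma app_left_c: "app (left_c c Q) u = scal c (app Q u)"
  by (induction Q rule: poly_mapping_additive_induct)
     (simp_all add: left_c_def mult_single app_single app_add_left distrib_left scale_right_distrib)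

end

lemma lookup_map_sderiv: "lookup (Poly_Mapping.map (sderiv i) P) k = sderiv i (lookup P k)"
  by (simp add: Poly_Mapping.map.rep_eq when_def)

lemma map_sderiv_add:
  "Poly_Mapping.map (sderiv i) (P + Q) = Poly_Mapping.map (sderiv i) P + Poly_Mapping.map (sderiv i) Q"
  by (rule poly_mapping_eqI) (simp add: lookup_add sderiv_add lookup_map_sderiv)

lemma left_d_add: "left_d i (P + Q) = left_d i P + left_d i Q"
  by (simp add: left_d_def map_sderiv_add distrib_left)

lemma left_d_0 [simp]: "left_d i 0 = 0"
  by (rule poly_mapping_eqI) (simp add: left_d_def lookup_map_sderiv)

lemma left_d_single:
  "left_d i (Poly_Mapping.single \<beta> c)
    = Poly_Mapping.single \<beta> (sderiv i c) + Poly_Mapping.single (\<beta> + Poly_Mapping.single i 1) c"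
  by (simp add: left_d_def mult_single add.commute)

lemma (in diff_module) app_left_d: "app (left_d i Q) u = nabla i (app Q u)"
  by (induction Q rule: poly_mapping_additive_induct)
     (simp_all add: left_d_single left_d_add app_single app_add_left nabla_add nabla_scal nabla_multi_pow)

lemma (in diff_module) app_multi_pow:
  "app (multi_pow left_d \<beta> Q) u = multi_pow nabla \<beta> (app Q u)"
proof -
  have pow: "app ((left_d j ^^ k) Q) u = (nabla j ^^ k) (app Q u)" for j k Q
    by (induction k) (simp_all add: app_left_d)
  have "app (foldr (\<lambda>j. left_d j ^^ lookup \<beta> j) xs Q) u
      = foldr (\<lambda>j. nabla j ^^ lookup \<beta> j) xs (app Q u)" for xs
    by (induction xs) (simp_all add: pow)
  then show ?thesis by (simp add: multi_pow_def)
qed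

interpretation weyl_self: diff_module left_c left_d
proof
  fix c d i j and P Q :: "('n::{finite,linorder} \<Rightarrow>\<^sub>0 nat) \<Rightarrow>\<^sub>0 'n ratfun poly"
  show "left_c c (P + Q) = left_c c P + left_c c Q"
    "left_c (c + d) P = left_c c P + left_c d P"
    "left_c c (left_c d P) = left_c (c * d) P" "left_c 1 P = P"
    by (simp_all add: left_c_def algebra_simps single_add mult_single flip: mult.assoc)
  show "left_d i (P + Q) = left_d i P + left_d i Q"
    by (rule left_d_add)
  show "left_d i (left_d j P) = left_d j (left_d i P)"
    by (induction P rule: poly_mapping_additive_induct)
       (simp_all add: left_d_single left_d_add algebra_simps sderiv_commute[of i j])
  show "left_d i (left_c c P) = left_c (sderiv i c) P + left_c c (left_d i P)"
    by (induction P rule: poly_mapping_additive_induct)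
       (simp_all add: left_d_single left_d_add left_c_def mult_single algebra_simps sderiv_mult single_add)
qed

lemma (in diff_module) app_app: "app (weyl_self.app P Q) u = app P (app Q u)"
proof (induction P rule: poly_mapping_additive_induct)
  case (single \<beta> c)
  then show ?case
    by (simp add: app_single weyl_self.app_single app_left_c app_multi_pow)
qed (simp_all add: app_add_left weyl_self.app_add_left)

lemma weyl_self_multi_pow_single:
  "multi_pow left_d \<beta> (Poly_Mapping.single 0 1) = Poly_Mapping.single \<beta> 1"
proof -
  have pow: "(left_d j ^^ k) (Poly_Mapping.single \<gamma> 1)
      = Poly_Mapping.single (\<gamma> + Poly_Mapping.single j k) 1" for j k \<gamma>
    by (induction k) (simp_all add: left_d_single add.assoc flip: single_add)
  have "foldr (\<lambda>j. left_d j ^^ lookup \<beta> j) xs (Poly_Mapping.single 0 1)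
      = Poly_Mapping.single (\<Sum>j\<leftarrow>xs. Poly_Mapping.single j (lookup \<beta> j)) 1" for xs
    by (induction xs) (simp_all add: pow add.commute)
  moreover have "(\<Sum>j\<leftarrow>sorted_list_of_set UNIV. Poly_Mapping.single j (lookup \<beta> j)) = \<beta>"
    by (intro poly_mapping_eqI)
       (simp add: sum_list_distinct_conv_sum_set lookup_sum lookup_single when_def)
  ultimately show ?thesis by (simp add: multi_pow_def)
qed

instantiation weyl :: ("{finite,linorder}") ring_1
begin

lift_definition zero_weyl :: "'a weyl" is 0 .
lift_definition one_weyl :: "'a weyl" is "Poly_Mapping.single 0 1" .
lift_definition plus_weyl :: "'a weyl \<Rightarrow> 'a weyl \<Rightarrow> 'a weyl" is "(+)" .
lift_definition minus_weyl :: "'a weyl \<Rightarrow> 'a weyl \<Rightarrow> 'a weyl" is "(-)" .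
lift_definition uminus_weyl :: "'a weyl \<Rightarrow> 'a weyl" is uminus .
lift_definition times_weyl :: "'a weyl \<Rightarrow> 'a weyl \<Rightarrow> 'a weyl" is "op_apply left_c left_d" .

instance
proof
  fix P Q R :: "'a weyl"
  show "P * Q * R = P * (Q * R)"
    by transfer (rule weyl_self.app_app)
  show "(P + Q) * R = P * R + Q * R" "P * (Q + R) = P * Q + P * R"
    by (transfer, rule weyl_self.app_add_left weyl_self.app_add_right)+
  show "1 * P = P"
    by transfer (use weyl_self.app_single[of 0 1] in \<open>simp add: left_c_def\<close>)
  show "P * 1 = P"
  proof transfer
    fix P :: "('a \<Rightarrow>\<^sub>0 nat) \<Rightarrow>\<^sub>0 'a ratfun poly"
    show "weyl_self.app P (Poly_Mapping.single 0 1) = P"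
    proof (induction P rule: poly_mapping_additive_induct)
      case (single \<beta> c)
      show ?case
        using weyl_self_multi_pow_single[of \<beta>]
        unfolding weyl_self.app_single by (simp add: left_c_def mult_single)
    qed (simp_all add: weyl_self.app_add_left)
  qed
  show "(0::'a weyl) \<noteq> 1"
    by transfer simp
qed (transfer, simp add: algebra_simps)+

end

definition w_coef :: "'n::{finite,linorder} ratfun poly \<Rightarrow> 'n weyl"
  where "w_coef c = Weyl (Poly_Mapping.single 0 c)"

definition w_d :: "'n::{finite,linorder} \<Rightarrow> 'n weyl"
  where "w_d i = Weyl (Poly_Mapping.single (Poly_Mapping.single i 1) 1)"

lemma wcoeffs_w_coef: "wcoeffs (w_coef c) = Poly_Mapping.single 0 c"
  by (simp add: w_coef_def Weyl_inverse)

lemma wcoeffs_w_d: "wcoeffs (w_d i) = Poly_Mapping.single (Poly_Mapping.single i 1) 1"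
  by (simp add: w_d_def Weyl_inverse)

lemmas wcoeffs_simps =
  wcoeffs_w_coef wcoeffs_w_d zero_weyl.rep_eq one_weyl.rep_eq plus_weyl.rep_eq times_weyl.rep_eq

text \<open>The defining relations (\<open>s\<close> is \<open>w_coef [:0, 1:]\<close>, and \<open>x\<^sub>i\<close> is \<open>w_coef [:rf_var i:]\<close>).\<close>

lemma w_coef_add: "w_coef (c + d) = w_coef c + w_coef d"
  by (simp add: wcoeffs_simps single_add flip: wcoeffs_inject)

lemma w_coef_mult: "w_coef (c * d) = w_coef c * w_coef d"
  by (simp add: wcoeffs_simps weyl_self.app_single left_c_def mult_single flip: wcoeffs_inject)

lemma w_coef_0 [simp]: "w_coef 0 = 0"
  by (simp add: wcoeffs_simps flip: wcoeffs_inject)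

lemma w_coef_1 [simp]: "w_coef 1 = 1"
  by (simp add: wcoeffs_simps flip: wcoeffs_inject)

lemma wcoeffs_w_d_mult: "wcoeffs (w_d i * Q) = left_d i (wcoeffs Q)"
proof -
  have "multi_pow left_d (Poly_Mapping.single i 1) (wcoeffs Q) = left_d i (wcoeffs Q)"
    using weyl_self.nabla_multi_pow[of i 0 "wcoeffs Q"] by simp
  then show ?thesis
    by (simp add: wcoeffs_simps weyl_self.app_single)
qed

lemma w_d_commute: "w_d i * w_d j = w_d j * w_d i"
  by (simp add: wcoeffs_w_d_mult wcoeffs_w_d left_d_single add.commute flip: wcoeffs_inject)

lemma w_d_coef: "w_d i * w_coef c = w_coef c * w_d i + w_coef (sderiv i c)"
proof -
  have "wcoeffs (w_coef c * w_d i) = Poly_Mapping.single (Poly_Mapping.single i 1) c"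
    by (simp add: wcoeffs_simps weyl_self.app_single left_c_def mult_single)
  moreover have "wcoeffs (w_d i * w_coef c)
      = Poly_Mapping.single (Poly_Mapping.single i 1) c + Poly_Mapping.single 0 (sderiv i c)"
    by (simp add: wcoeffs_w_d_mult wcoeffs_w_coef left_d_single add.commute)
  ultimately show ?thesis
    by (simp add: wcoeffs_w_coef plus_weyl.rep_eq flip: wcoeffs_inject)
qed

lemma w_d_var: "w_d i * w_coef [:rf_var j:] = w_coef [:rf_var j:] * w_d i + (if i = j then 1 else 0)"
proof -
  have "sderiv i [:rf_var j:] = (if i = j then 1 else 0)"
    by (auto simp: poly_eq_iff coeff_sderiv coeff_pCons rf_deriv_var split: nat.splits)
  then show ?thesis
    by (simp add: w_d_coef)
qed

lemma w_d_s: "w_d i * w_coef [:0, 1:] = w_coef [:0, 1:] * w_d i"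
proof -
  have "sderiv i [:0, 1:] = 0"
    by (auto simp: poly_eq_iff coeff_sderiv coeff_pCons split: nat.splits)
  then show ?thesis
    by (simp add: w_d_coef)
qed

text \<open>For a subring \<open>A\<close> of the rational functions: the Weyl algebra with coefficients in \<open>A[s]\<close>.\<close>

definition weyl_s_over :: "'n::{finite,linorder} ratfun set \<Rightarrow> 'n weyl set"
  where "weyl_s_over A = {P. \<forall>\<beta> j. coeff (lookup (wcoeffs P) \<beta>) j \<in> A}"

definition D_s :: "'n::{finite,linorder} weyl set"
  where "D_s = weyl_s_over (range rf_of_mp)"

definition D_s_at :: "complex ^ ('n::{finite,linorder}) \<Rightarrow> 'n weyl set"
  where "D_s_at p = weyl_s_over (local_ring p)"

definition left_ideal :: "'a::ring_1 set \<Rightarrow> 'a set \<Rightarrow> bool"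
  where "left_ideal R J \<longleftrightarrow>
    J \<subseteq> R \<and> 0 \<in> J \<and> (\<forall>a\<in>J. \<forall>b\<in>J. a + b \<in> J) \<and> (\<forall>r\<in>R. \<forall>a\<in>J. r * a \<in> J)"

definition left_ideal_gen :: "'a::ring_1 set \<Rightarrow> 'a set \<Rightarrow> 'a set"
  where "left_ideal_gen R G = left_ideal R hull G"


section \<open>The action on f to the power s\<close>

text \<open>
  The symbol \<open>f\<^sup>s\<close> is suppressed: \<open>g\<close> stands for \<open>g \<cdot> f\<^sup>s\<close>, so that \<open>1\<close> is \<open>f\<^sup>s\<close> and \<open>of_cx f\<close> is
  \<open>f \<cdot> f\<^sup>s\<close>. The free modules of rank one over \<open>\<complex>[x][s,1/f]\<close> and over its localization at a point
  are contained in the one over the polynomials in \<open>s\<close> with rational function coefficients, on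
  which the action is defined by the same formula.
\<close>

definition fs_nabla :: "'n::{finite,linorder} mpoly \<Rightarrow> 'n \<Rightarrow> 'n ratfun poly \<Rightarrow> 'n ratfun poly"
  where "fs_nabla f i g = sderiv i g + [:0, 1:] * g * [:rf_of_mp (mp_deriv i f) / rf_of_mp f:]"

definition fs_act :: "'n::{finite,linorder} mpoly \<Rightarrow> 'n weyl \<Rightarrow> 'n ratfun poly \<Rightarrow> 'n ratfun poly"
  where "fs_act f P g = op_apply (*) (fs_nabla f) (wcoeffs P) g"

lemma rf_log_deriv_commute:
  "rf_deriv i (rf_of_mp (mp_deriv j f) / rf_of_mp f) = rf_deriv j (rf_of_mp (mp_deriv i f) / rf_of_mp f)"
proof (cases "f = 0")
  case False
  then show ?thesis
    by (simp add: rf_of_mp_def rf_deriv_Fract mp_deriv_commute[of i j] mult.commute)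
qed (simp add: rf_of_mp_def flip: Zero_fract_def)

lemma fs_diff_module:
  fixes f :: "'n::{finite,linorder} mpoly"
  shows "diff_module (*) (fs_nabla f)"
proof
  fix i j and c g h :: "'n ratfun poly"
  let ?l = "\<lambda>i. [:rf_of_mp (mp_deriv i f) / rf_of_mp f:]"
  show "fs_nabla f i (g + h) = fs_nabla f i g + fs_nabla f i h"
    by (simp add: fs_nabla_def sderiv_add algebra_simps del: mult_pCons_left mult_pCons_right)
  have s: "sderiv i [:0, 1:] = 0" for i :: 'n
    by (auto simp: poly_eq_iff coeff_sderiv coeff_pCons split: nat.splits)
  have l: "sderiv i (?l j) = sderiv j (?l i)"
    by (auto simp: poly_eq_iff coeff_sderiv coeff_pCons rf_log_deriv_commute[of i j] split: nat.splits)
  show "fs_nabla f i (fs_nabla f j g) = fs_nabla f j (fs_nabla f i g)"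
    using l
    by (simp add: fs_nabla_def sderiv_add sderiv_mult s sderiv_commute[of i j] algebra_simps
        del: mult_pCons_left mult_pCons_right)
  show "fs_nabla f i (c * g) = sderiv i c * g + c * fs_nabla f i g"
    by (simp add: fs_nabla_def sderiv_mult algebra_simps del: mult_pCons_left mult_pCons_right)
qed (simp_all add: algebra_simps)

lemma fs_act_mult: "fs_act f (P * Q) g = fs_act f P (fs_act f Q g)"
  unfolding fs_act_def times_weyl.rep_eq by (rule diff_module.app_app[OF fs_diff_module])

lemma fs_act_coef: "fs_act f (w_coef c) g = c * g"
  unfolding fs_act_def wcoeffs_w_coef
  by (simp add: diff_module.app_single[OF fs_diff_module] diff_module.multi_pow_0[OF fs_diff_module])

lemma fs_act_d: "fs_act f (w_d i) g = fs_nabla f i g"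
proof -
  have "multi_pow (fs_nabla f) (Poly_Mapping.single i 1) g = fs_nabla f i g"
    using diff_module.nabla_multi_pow[OF fs_diff_module, of f i 0 g]
    by (simp add: diff_module.multi_pow_0[OF fs_diff_module])
  then show ?thesis
    unfolding fs_act_def wcoeffs_w_d by (simp add: diff_module.app_single[OF fs_diff_module])
qed

definition ann_fs :: "'n::{finite,linorder} mpoly \<Rightarrow> 'n weyl set"
  where "ann_fs f = {P \<in> D_s. fs_act f P 1 = 0}"

definition local_b_equation :: "'n mpoly \<Rightarrow> complex ^ ('n::{finite,linorder}) \<Rightarrow> complex poly \<Rightarrow> bool"
  where "local_b_equation f p b \<longleftrightarrow> (\<exists>P\<in>D_s_at p. fs_act f P (of_cx f) = of_cs b)"

text \<open>
  This is a predicate and not a function, because the existence of the local b-function is a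
  theorem (of Bernstein); its uniqueness is immediate from the minimality of the degree.
\<close>

definition is_local_b_function :: "'n mpoly \<Rightarrow> complex ^ ('n::{finite,linorder}) \<Rightarrow> complex poly \<Rightarrow> bool"
  where "is_local_b_function f p b \<longleftrightarrow> lead_coeff b = 1 \<and> local_b_equation f p b \<and>
    (\<forall>c. lead_coeff c = 1 \<longrightarrow> local_b_equation f p c \<longrightarrow> degree b \<le> degree c)"

end

theory Submission
  imports Defs
begin

text \<open>
  Everything rests on two facts about the ideal \<open>I\<close> generated by the annihilator of \<open>f\<^sup>s\<close>, \<open>f\<close>
  and \<open>s + a\<close>: after localization at \<open>p\<close> it is the whole ring iff \<open>s + a\<close> does not divide the
  local b-function \<open>b\<close>, and this happens iff \<open>I\<close> contains a polynomial \<open>h\<close> in the variables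
  \<open>x\<close> with \<open>h(p) \<noteq> 0\<close>, a common denominator of the local operators involved.

  Suppose \<open>s + a\<close> divides \<open>b\<close>, say \<open>b = (s + a) q\<close>, and yet some \<open>g \<in> I\<close> has \<open>g(p) \<noteq> 0\<close>.
  Membership in \<open>I\<close> gives \<open>g \<cdot> f\<^sup>s = B f \<cdot> f\<^sup>s + C (s + a) \<cdot> f\<^sup>s\<close> with global operators \<open>B\<close> and
  \<open>C\<close> (lemma \<open>left_ideal_gen_acts\<close>). As \<open>q\<close> is central, multiplication by \<open>q\<close> turns the last term
  into \<open>C b \<cdot> f\<^sup>s = C P f \<cdot> f\<^sup>s\<close>, where \<open>P\<close> is the operator of the functional equation for \<open>b\<close>.
  Division by \<open>g\<close>, a unit at \<open>p\<close>, yields a functional equation for \<open>q\<close>, whose degree is too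
  small (lemma \<open>root_imp_vanishing\<close>).

  Conversely, if \<open>s + a\<close> does not divide \<open>b\<close>, then \<open>1 = e b - e q (s + a)\<close> in \<open>\<complex>[s]\<close> for a
  constant \<open>e\<close> and some \<open>q\<close>. Choose \<open>h\<close> with \<open>h(p) \<noteq> 0\<close> such that \<open>h P\<close> has polynomial coefficients
  (lemma \<open>clear_denominators\<close>). Then \<open>h - (e h P f - e q h (s + a))\<close> is a global operator that
  annihilates \<open>f\<^sup>s\<close>, and so \<open>h \<in> I\<close> (lemma \<open>not_root_imp_nonvanishing\<close>).
\<close>

section \<open>Evaluation of polynomials\<close>

lemma mp_eval_single:
  "mp_eval (Poly_Mapping.single m c) p = c * (\<Prod>i\<in>UNIV. (p $ i) ^ lookup m i)"
  by (simp add: mp_eval_def)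

lemma mp_eval_0: "mp_eval 0 p = 0"
  by (simp add: mp_eval_def)

lemma mp_eval_1: "mp_eval 1 p = 1"
  using mp_eval_single[of 0 1 p] by simp

lemma mp_eval_add: "mp_eval (g + h) p = mp_eval g p + mp_eval h p"
  unfolding mp_eval_def
  by (rule keys_sum_add[where F = "\<lambda>m c. c * (\<Prod>i\<in>UNIV. (p $ i) ^ lookup m i)"])
     (simp_all add: distrib_right)

lemma mp_eval_mult: "mp_eval (g * h) p = mp_eval g p * mp_eval h p"
proof (induction g rule: poly_mapping_additive_induct)
  case (single m a)
  show ?case
    by (induction h rule: poly_mapping_additive_induct)
       (simp_all add: mp_eval_0 mp_eval_add mp_eval_single mult_single lookup_add power_add
          prod.distrib algebra_simps)
qed (simp_all add: mp_eval_0 mp_eval_add algebra_simps)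

section \<open>Polynomials and local rings as differential subrings of the rational functions\<close>

lemma rf_of_mp_0: "rf_of_mp 0 = 0"
  by (simp add: rf_of_mp_def Zero_fract_def)

lemma rf_of_mp_1: "rf_of_mp 1 = 1"
  by (simp add: rf_of_mp_def One_fract_def)

lemma rf_of_mp_add: "rf_of_mp (g + h) = rf_of_mp g + rf_of_mp h"
  by (simp add: rf_of_mp_def)

lemma rf_of_mp_mult: "rf_of_mp (g * h) = rf_of_mp g * rf_of_mp h"
  by (simp add: rf_of_mp_def)

lemma rf_of_mp_diff: "rf_of_mp (g - h) = rf_of_mp g - rf_of_mp h"
  by (simp add: rf_of_mp_def)

lemma rf_of_mp_eq_0_iff: "rf_of_mp g = 0 \<longleftrightarrow> g = 0"
  by (simp add: rf_of_mp_def Zero_fract_def eq_fract)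

lemma rf_const_0: "rf_const 0 = 0"
  by (simp add: rf_const_def rf_of_mp_0)

lemma rf_const_1: "rf_const 1 = 1"
  by (simp add: rf_const_def rf_of_mp_1)

lemma rf_const_add: "rf_const (a + b) = rf_const a + rf_const b"
  by (simp add: rf_const_def single_add rf_of_mp_add)

lemma rf_const_mult: "rf_const (a * b) = rf_const a * rf_const b"
  by (simp add: rf_const_def mult_single flip: rf_of_mp_mult)

text \<open>
  Closure under the derivations is what makes the operators with coefficients in \<open>A[s]\<close> closed
  under composition. The notion covers the global and the local Weyl algebras at once.
\<close>

locale diff_subring =
  fixes A :: "'n::{finite,linorder} ratfun set"
  assumes zero_in: "0 \<in> A" and one_in: "1 \<in> A"
    and add_in: "a \<in> A \<Longrightarrow> b \<in> A \<Longrightarrow> a + b \<in> A"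
    and mult_in: "a \<in> A \<Longrightarrow> b \<in> A \<Longrightarrow> a * b \<in> A"
    and deriv_in: "a \<in> A \<Longrightarrow> rf_deriv i a \<in> A"

lemma diff_subring_polynomials: "diff_subring (range rf_of_mp)"
  by unfold_locales
     (auto simp: rf_deriv_of_mp image_iff simp flip: rf_of_mp_0 rf_of_mp_1 rf_of_mp_add rf_of_mp_mult)

lemma local_ringI: "mp_eval h p \<noteq> 0 \<Longrightarrow> Fract g h \<in> local_ring p"
  by (auto simp: local_ring_def)

lemma diff_subring_local_ring: "diff_subring (local_ring p)"
proof
  have nz: "h \<noteq> 0" if "mp_eval h p \<noteq> 0" for h
    using that mp_eval_0 by metis
  show "0 \<in> local_ring p" "1 \<in> local_ring p"
    unfolding Zero_fract_def One_fract_def by (rule local_ringI, simp add: mp_eval_1)+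
  fix a b i assume "a \<in> local_ring p"
  then obtain g h where a: "a = Fract g h" "mp_eval h p \<noteq> 0"
    by (auto simp: local_ring_def)
  show "rf_deriv i a \<in> local_ring p"
    using a nz by (simp add: rf_deriv_Fract local_ringI mp_eval_mult)
  assume "b \<in> local_ring p"
  then obtain g' h' where b: "b = Fract g' h'" "mp_eval h' p \<noteq> 0"
    by (auto simp: local_ring_def)
  show "a + b \<in> local_ring p" "a * b \<in> local_ring p"
    using a b nz by (simp_all add: local_ringI mp_eval_mult)
qed

lemma polynomials_subset_local_ring: "range rf_of_mp \<subseteq> local_ring p"
  by (auto simp: rf_of_mp_def mp_eval_1 intro: local_ringI)

lemma inverse_in_local_ring:
  assumes "mp_eval g p \<noteq> 0"
  shows "inverse (rf_of_mp g) \<in> local_ring p"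
  using assms by (simp add: rf_of_mp_def local_ringI)

lemma common_denominator:
  assumes "finite X" "X \<subseteq> local_ring p"
  shows "\<exists>h. mp_eval h p \<noteq> 0 \<and> (\<forall>x\<in>X. rf_of_mp h * x \<in> range rf_of_mp)"
  using assms
proof (induction X rule: finite_induct)
  case empty
  show ?case by (intro exI[of _ 1]) (simp add: mp_eval_1)
next
  case (insert x X)
  then obtain h where h: "mp_eval h p \<noteq> 0" "\<forall>x\<in>X. rf_of_mp h * x \<in> range rf_of_mp"
    by auto
  obtain g k where x: "x = Fract g k" "mp_eval k p \<noteq> 0"
    using insert.prems by (auto simp: local_ring_def)
  then have "k \<noteq> 0"
    using mp_eval_0 by metis
  then have "rf_of_mp k * x = rf_of_mp g"
    by (simp add: rf_of_mp_def x eq_fract mult.commute)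
  then have "rf_of_mp (k * h) * x = rf_of_mp (h * g)"
    by (simp add: rf_of_mp_mult mult_ac)
  moreover have "rf_of_mp (k * h) * y \<in> range rf_of_mp" if "y \<in> X" for y
  proof -
    obtain z where "rf_of_mp h * y = rf_of_mp z"
      using h(2) \<open>y \<in> X\<close> by blast
    then have "rf_of_mp (k * h) * y = rf_of_mp (k * z)"
      by (simp add: rf_of_mp_mult mult.assoc)
    then show ?thesis by simp
  qed
  ultimately show ?case
    using h(1) x(2) by (intro exI[of _ "k * h"]) (auto simp: mp_eval_mult)
qed

section \<open>Weyl algebras over differential subrings\<close>

lemma lookup_left_c: "lookup (left_c c Q) \<beta> = c * lookup Q \<beta>"
  by (induction Q rule: poly_mapping_additive_induct)
     (simp_all add: left_c_def mult_single lookup_single when_def distrib_left lookup_add)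

lemma lookup_wcoeffs_coef_mult: "lookup (wcoeffs (w_coef c * P)) \<beta> = c * lookup (wcoeffs P) \<beta>"
  by (simp add: wcoeffs_simps weyl_self.app_single lookup_left_c)

context diff_subring
begin

lemma sum_in: "(\<And>k. k \<in> K \<Longrightarrow> F k \<in> A) \<Longrightarrow> sum F K \<in> A"
  by (induction K rule: infinite_finite_induct) (simp_all add: zero_in add_in)

definition polys :: "'n ratfun poly set"
  where "polys = {c. \<forall>j. coeff c j \<in> A}"

definition normal_forms :: "(('n \<Rightarrow>\<^sub>0 nat) \<Rightarrow>\<^sub>0 'n ratfun poly) set"
  where "normal_forms = {Q. \<forall>\<beta>. lookup Q \<beta> \<in> polys}"

lemma weyl_s_over_iff: "P \<in> weyl_s_over A \<longleftrightarrow> wcoeffs P \<in> normal_forms"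
  by (simp add: weyl_s_over_def normal_forms_def polys_def)

lemma polys_0: "0 \<in> polys"
  by (simp add: polys_def zero_in)

lemma polys_add: "c \<in> polys \<Longrightarrow> d \<in> polys \<Longrightarrow> c + d \<in> polys"
  by (simp add: polys_def add_in)

lemma polys_mult: "c \<in> polys \<Longrightarrow> d \<in> polys \<Longrightarrow> c * d \<in> polys"
  by (auto simp: polys_def coeff_mult intro!: sum_in mult_in)

lemma polys_sderiv: "c \<in> polys \<Longrightarrow> sderiv i c \<in> polys"
  by (simp add: polys_def coeff_sderiv deriv_in)

lemma normal_forms_add: "Q \<in> normal_forms \<Longrightarrow> R \<in> normal_forms \<Longrightarrow> Q + R \<in> normal_forms"
  by (simp add: normal_forms_def lookup_add polys_add)

lemma normal_forms_single: "c \<in> polys \<Longrightarrow> Poly_Mapping.single \<beta> c \<in> normal_forms"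
  by (simp add: normal_forms_def lookup_single when_def polys_0)

lemma normal_forms_0: "0 \<in> normal_forms"
  by (simp add: normal_forms_def polys_0)

lemma normal_forms_left_c: "c \<in> polys \<Longrightarrow> Q \<in> normal_forms \<Longrightarrow> left_c c Q \<in> normal_forms"
  by (simp add: normal_forms_def lookup_left_c polys_mult)

lemma normal_forms_sum: "(\<And>k. k \<in> K \<Longrightarrow> F k \<in> normal_forms) \<Longrightarrow> sum F K \<in> normal_forms"
  by (induction K rule: infinite_finite_induct) (simp_all add: normal_forms_0 normal_forms_add)

text \<open>
  By additivity of \<^const>\<open>left_d\<close> only single terms \<open>c \<partial>\<^sup>\<beta>\<close> matter, on which it produces the
  coefficients \<open>c\<close> and \<open>\<partial>c/\<partial>x\<^sub>i\<close>.
\<close>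

lemma normal_forms_left_d:
  assumes "Q \<in> normal_forms"
  shows "left_d i Q \<in> normal_forms"
proof -
  have eq: "Q = (\<Sum>m\<in>keys Q. Poly_Mapping.single m (lookup Q m))"
    by (rule poly_mapping_eqI) (auto simp: lookup_sum lookup_single when_def in_keys_iff)
  have "left_d i Q = (\<Sum>m\<in>keys Q. left_d i (Poly_Mapping.single m (lookup Q m)))"
    by (subst eq) (rule weyl_self.nabla_sum)
  also have "\<dots> \<in> normal_forms"
    using assms unfolding left_d_single
    by (intro normal_forms_sum normal_forms_add normal_forms_single polys_sderiv)
       (simp_all add: normal_forms_def)
  finally show ?thesis .
qed

lemma normal_forms_multi_pow:
  assumes "Q \<in> normal_forms"
  shows "multi_pow left_d \<beta> Q \<in> normal_forms"
proof -
  have pow: "(left_d i ^^ k) R \<in> normal_forms" if "R \<in> normal_forms" for i k R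
    by (induction k) (simp_all add: that normal_forms_left_d)
  have "foldr (\<lambda>i. left_d i ^^ lookup \<beta> i) xs Q \<in> normal_forms" for xs
    by (induction xs) (simp_all add: assms pow)
  then show ?thesis by (simp add: multi_pow_def)
qed

lemma weyl_s_over_0: "0 \<in> weyl_s_over A"
  by (simp add: weyl_s_over_iff zero_weyl.rep_eq normal_forms_0)

lemma weyl_s_over_coef: "c \<in> polys \<Longrightarrow> w_coef c \<in> weyl_s_over A"
  by (simp add: weyl_s_over_iff wcoeffs_w_coef normal_forms_single)

lemma weyl_s_over_add: "P \<in> weyl_s_over A \<Longrightarrow> Q \<in> weyl_s_over A \<Longrightarrow> P + Q \<in> weyl_s_over A"
  by (simp add: weyl_s_over_iff plus_weyl.rep_eq normal_forms_add)

lemma weyl_s_over_mult: "P \<in> weyl_s_over A \<Longrightarrow> Q \<in> weyl_s_over A \<Longrightarrow> P * Q \<in> weyl_s_over A"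
  unfolding weyl_s_over_iff times_weyl.rep_eq op_apply_def
  by (intro normal_forms_sum normal_forms_left_c normal_forms_multi_pow)
     (simp_all add: normal_forms_def)

end

lemma weyl_s_over_mono: "A \<subseteq> B \<Longrightarrow> weyl_s_over A \<subseteq> weyl_s_over B"
  by (auto simp: weyl_s_over_def)

interpretation D_s: diff_subring "range rf_of_mp"
  by (rule diff_subring_polynomials)

interpretation D_s_at: diff_subring "local_ring p" for p
  by (rule diff_subring_local_ring)

lemmas D_s_closed =
  D_s.weyl_s_over_0[folded D_s_def] D_s.weyl_s_over_coef[folded D_s_def]
  D_s.weyl_s_over_add[folded D_s_def] D_s.weyl_s_over_mult[folded D_s_def]

lemmas D_s_at_closed =
  D_s_at.weyl_s_over_coef[folded D_s_at_def]
  D_s_at.weyl_s_over_add[folded D_s_at_def] D_s_at.weyl_s_over_mult[folded D_s_at_def]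

lemma D_s_diff:
  assumes "P \<in> D_s" "Q \<in> D_s"
  shows "P - Q \<in> D_s"
proof -
  have "x - y \<in> range rf_of_mp" if "x \<in> range rf_of_mp" "y \<in> range rf_of_mp" for x y :: "'a ratfun"
    using that by (auto simp flip: rf_of_mp_diff)
  then show ?thesis
    using assms by (simp add: D_s_def weyl_s_over_def minus_weyl.rep_eq lookup_minus)
qed

lemma D_s_subset_D_s_at: "D_s \<subseteq> D_s_at p"
  unfolding D_s_def D_s_at_def by (intro weyl_s_over_mono polynomials_subset_local_ring)

text \<open>
  Only multiplication by \<open>h\<close> from the left acts on a normal form coefficient by coefficient, so it
  is on this side that the finitely many denominators can be removed.
\<close>

lemma clear_denominators:
  assumes "P \<in> D_s_at p"
  shows "\<exists>h. mp_eval h p \<noteq> 0 \<and> w_coef (of_cx h) * P \<in> D_s"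
proof -
  define X where "X = (\<Union>\<beta>\<in>keys (wcoeffs P). set (coeffs (lookup (wcoeffs P) \<beta>)))"
  have "X \<subseteq> local_ring p"
    using assms by (auto simp: X_def D_s_at_def weyl_s_over_def coeffs_def split: if_splits)
  moreover have "finite X"
    by (simp add: X_def)
  ultimately obtain h where h: "mp_eval h p \<noteq> 0" "\<forall>x\<in>X. rf_of_mp h * x \<in> range rf_of_mp"
    using common_denominator by blast
  have "rf_of_mp h * coeff (lookup (wcoeffs P) \<beta>) j \<in> range rf_of_mp" for \<beta> j
  proof (cases "coeff (lookup (wcoeffs P) \<beta>) j = 0")
    case False
    then have "lookup (wcoeffs P) \<beta> \<noteq> 0" by auto
    moreover have "coeff (lookup (wcoeffs P) \<beta>) j \<in> set (coeffs (lookup (wcoeffs P) \<beta>))"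
      using False \<open>lookup (wcoeffs P) \<beta> \<noteq> 0\<close> le_degree[OF False] by (auto simp: coeffs_def simp del: upt_Suc)
    ultimately show ?thesis
      using h(2) by (auto simp: X_def in_keys_iff)
  qed (use D_s.zero_in in simp)
  then have "w_coef (of_cx h) * P \<in> D_s"
    by (simp add: D_s_def weyl_s_over_def lookup_wcoeffs_coef_mult of_cx_def)
  with h(1) show ?thesis by blast
qed

section \<open>Linearity of the action over the constants\<close>

text \<open>
  For \<open>c \<in> \<complex>[s]\<close> this says that operators act \<open>\<complex>[s]\<close>-linearly; it replaces computations with
  the central elements of the Weyl algebra.
\<close>

lemma (in diff_module) app_scal_constant:
  assumes "\<And>i. sderiv i c = 0"
  shows "app P (scal c u) = scal c (app P u)"
proof -
  have pow: "(nabla i ^^ k) (scal c v) = scal c ((nabla i ^^ k) v)" for i k v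
    by (induction k) (simp_all add: nabla_scal assms)
  have "foldr (\<lambda>i. nabla i ^^ lookup \<beta> i) xs (scal c u) = scal c (foldr (\<lambda>i. nabla i ^^ lookup \<beta> i) xs u)"
    for \<beta> xs
    by (induction xs) (simp_all add: pow)
  then have "multi_pow nabla \<beta> (scal c u) = scal c (multi_pow nabla \<beta> u)" for \<beta>
    by (simp add: multi_pow_def)
  then show ?thesis
    by (simp add: op_apply_def scale_sum_right mult.commute)
qed

lemma coeff_of_cs: "coeff (of_cs q) j = rf_const (coeff q j)"
  by (simp add: of_cs_def coeff_map_poly rf_const_0)

lemma sderiv_of_cs: "sderiv i (of_cs q) = 0"
  by (simp add: poly_eq_iff coeff_sderiv coeff_of_cs)

lemma of_cs_add: "of_cs (q + r) = of_cs q + of_cs r"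
  by (simp add: poly_eq_iff coeff_of_cs rf_const_add)

lemma rf_const_sum: "rf_const (sum F K) = (\<Sum>k\<in>K. rf_const (F k))"
  by (induction K rule: infinite_finite_induct) (simp_all add: rf_const_0 rf_const_add)

lemma of_cs_mult: "of_cs (q * r) = of_cs q * of_cs r"
  by (simp add: poly_eq_iff coeff_of_cs coeff_mult rf_const_sum rf_const_mult)

lemma of_cs_1: "of_cs 1 = 1"
  by (auto simp: poly_eq_iff coeff_of_cs rf_const_0 rf_const_1)

lemma fs_act_of_cs: "fs_act f P (of_cs q * g) = of_cs q * fs_act f P g"
  unfolding fs_act_def by (intro diff_module.app_scal_constant[OF fs_diff_module] sderiv_of_cs)

lemma fs_act_add_left: "fs_act f (P + Q) g = fs_act f P g + fs_act f Q g"
  unfolding fs_act_def plus_weyl.rep_eq by (rule diff_module.app_add_left[OF fs_diff_module])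

lemma fs_act_add_right: "fs_act f P (g + h) = fs_act f P g + fs_act f P h"
  unfolding fs_act_def by (rule diff_module.app_add_right[OF fs_diff_module])

lemma fs_act_0_left: "fs_act f 0 g = 0"
  unfolding fs_act_def zero_weyl.rep_eq by (rule diff_module.app_0_left[OF fs_diff_module])

lemma fs_act_diff_left: "fs_act f (P - Q) g = fs_act f P g - fs_act f Q g"
  using fs_act_add_left[of f "P - Q" Q g] by simp

lemma of_cs_in_D_s: "w_coef (of_cs q) \<in> D_s"
  by (intro D_s_closed) (simp add: D_s.polys_def coeff_of_cs rf_const_def)

lemma of_cx_in_D_s: "w_coef (of_cx g) \<in> D_s"
  by (intro D_s_closed)
     (auto simp: D_s.polys_def of_cx_def coeff_pCons D_s.zero_in split: nat.splits)

section \<open>Left ideals\<close>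

lemma left_ideal_gen_minimal: "left_ideal R J \<Longrightarrow> G \<subseteq> J \<Longrightarrow> left_ideal_gen R G \<subseteq> J"
  unfolding left_ideal_gen_def by (rule hull_minimal)

lemma left_ideal_gen_superset: "G \<subseteq> left_ideal_gen R G"
  unfolding left_ideal_gen_def by (rule hull_subset)

lemma left_ideal_gen_mono: "G \<subseteq> H \<Longrightarrow> left_ideal_gen R G \<subseteq> left_ideal_gen R H"
  unfolding left_ideal_gen_def by (rule hull_mono)

lemma left_ideal_gen_add:
  "a \<in> left_ideal_gen R G \<Longrightarrow> b \<in> left_ideal_gen R G \<Longrightarrow> a + b \<in> left_ideal_gen R G"
  unfolding left_ideal_gen_def hull_def by (auto simp: left_ideal_def)

lemma left_ideal_gen_mult:
  "r \<in> R \<Longrightarrow> a \<in> left_ideal_gen R G \<Longrightarrow> r * a \<in> left_ideal_gen R G"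
  unfolding left_ideal_gen_def hull_def by (auto simp: left_ideal_def)

text \<open>
  The operators with a representation as in the conclusion form a left ideal containing the
  generators. The annihilator part disappears on application to \<open>f\<^sup>s\<close>, so what remains
  of a membership in the ideal is an identity in the module.
\<close>

lemma left_ideal_gen_acts:
  fixes f :: "'n::{finite,linorder} mpoly"
  assumes G: "G \<subseteq> ann_fs f"
    and P: "P \<in> left_ideal_gen D_s (G \<union> {w_coef (of_cx f), w_coef u})"
    and u: "w_coef u \<in> D_s"
  shows "\<exists>B\<in>D_s. \<exists>C\<in>D_s. fs_act f P 1 = fs_act f B (of_cx f) + fs_act f C u"
proof -
  define K where "K = {P \<in> D_s. \<exists>B\<in>D_s. \<exists>C\<in>D_s. fs_act f P 1 = fs_act f B (of_cx f) + fs_act f C u}"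
  have K: "P \<in> K" if "P \<in> D_s" "B \<in> D_s" "C \<in> D_s"
      "fs_act f P 1 = fs_act f B (of_cx f) + fs_act f C u" for P B C
    using that by (auto simp: K_def)
  have one: "1 \<in> D_s"
    using of_cs_in_D_s[of 1] by (simp add: of_cs_1)
  have "left_ideal D_s K"
    unfolding left_ideal_def
  proof (intro conjI ballI)
    show "K \<subseteq> D_s" by (auto simp: K_def)
    show "0 \<in> K" by (rule K[of 0 0 0]) (simp_all add: D_s_closed fs_act_0_left)
  next
    fix P Q assume "P \<in> K" "Q \<in> K"
    then obtain B C B' C' where "P \<in> D_s" "Q \<in> D_s" "B \<in> D_s" "C \<in> D_s" "B' \<in> D_s" "C' \<in> D_s"
      "fs_act f P 1 = fs_act f B (of_cx f) + fs_act f C u"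
      "fs_act f Q 1 = fs_act f B' (of_cx f) + fs_act f C' u"
      by (auto simp: K_def)
    then show "P + Q \<in> K"
      by (intro K[of _ "B + B'" "C + C'"]) (simp_all add: D_s_closed fs_act_add_left)
  next
    fix R P :: "'n weyl" assume "R \<in> D_s" "P \<in> K"
    then obtain B C where "P \<in> D_s" "B \<in> D_s" "C \<in> D_s"
      "fs_act f P 1 = fs_act f B (of_cx f) + fs_act f C u"
      by (auto simp: K_def)
    with \<open>R \<in> D_s\<close> show "R * P \<in> K"
      by (intro K[of _ "R * B" "R * C"]) (simp_all add: D_s_closed fs_act_mult fs_act_add_right)
  qed
  moreover have "G \<union> {w_coef (of_cx f), w_coef u} \<subseteq> K"
  proof -
    have "G \<subseteq> K"
      using G by (auto simp: ann_fs_def fs_act_0_left D_s_closed intro!: K[of _ 0 0])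
    moreover have "w_coef (of_cx f) \<in> K"
      using fs_act_coef[of f 1] one
      by (intro K[of _ 1 0]) (simp_all add: of_cx_in_D_s D_s_closed fs_act_coef fs_act_0_left)
    moreover have "w_coef u \<in> K"
      using fs_act_coef[of f 1] one
      by (intro K[of _ 0 1]) (simp_all add: u D_s_closed fs_act_coef fs_act_0_left)
    ultimately show ?thesis by simp
  qed
  ultimately have "P \<in> K"
    using left_ideal_gen_minimal P by blast
  then show ?thesis by (simp add: K_def)
qed

section \<open>The criterion\<close>

text \<open>
  Otherwise the cofactor of \<open>s + a\<close> in \<open>b\<close> would satisfy a local functional equation too,
  against the minimality of the degree of \<open>b\<close>.
\<close>

lemma root_imp_vanishing:
  assumes G: "left_ideal_gen D_s G = ann_fs f" and b: "is_local_b_function f p b"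
    and dvd: "[:a, 1:] dvd b"
    and g: "w_coef (of_cx g) \<in> left_ideal_gen D_s (G \<union> {w_coef (of_cx f), w_coef (of_cs [:a, 1:])})"
  shows "mp_eval g p = 0"
proof (rule ccontr)
  assume gp: "mp_eval g p \<noteq> 0"
  then have "g \<noteq> 0" by (metis mp_eval_0)
  obtain B C where BC: "B \<in> D_s" "C \<in> D_s"
      "of_cx g = fs_act f B (of_cx f) + fs_act f C (of_cs [:a, 1:])"
    using left_ideal_gen_acts[OF _ g of_cs_in_D_s] left_ideal_gen_superset[of G D_s] G
    by (auto simp: fs_act_coef)
  obtain P where P: "P \<in> D_s_at p" "fs_act f P (of_cx f) = of_cs b"
    using b by (auto simp: is_local_b_function_def local_b_equation_def)
  obtain q where q: "b = [:a, 1:] * q"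
    using dvd by blast
  \<comment> \<open>The reciprocal of \<open>g\<close> is a legitimate coefficient of local operators because \<open>g(p) \<noteq> 0\<close>.\<close>
  define v where "v = [:inverse (rf_of_mp g):]"
  have v: "v * of_cx g = 1"
    using \<open>g \<noteq> 0\<close> by (simp add: v_def of_cx_def rf_of_mp_eq_0_iff one_pCons)
  have "of_cs q * of_cx g = of_cs q * fs_act f B (of_cx f) + fs_act f C (of_cs b)"
    unfolding BC(3) q mult.commute[of "[:a, 1:]" q] of_cs_mult fs_act_of_cs by (rule distrib_left)
  also have "\<dots> = fs_act f (w_coef (of_cs q) * B + C * P) (of_cx f)"
    by (simp add: fs_act_add_left fs_act_mult fs_act_coef P(2))
  finally have "of_cs q = fs_act f (w_coef v * (w_coef (of_cs q) * B + C * P)) (of_cx f)"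
    using v by (metis fs_act_mult fs_act_coef mult.left_commute mult.right_neutral)
  moreover have "w_coef v * (w_coef (of_cs q) * B + C * P) \<in> D_s_at p"
  proof -
    have "v \<in> D_s_at.polys p"
      using gp by (auto simp: v_def D_s_at.polys_def coeff_pCons inverse_in_local_ring D_s_at.zero_in split: nat.splits)
    moreover have "w_coef (of_cs q) \<in> D_s_at p" "B \<in> D_s_at p" "C \<in> D_s_at p"
      using BC(1,2) D_s_subset_D_s_at[of p] of_cs_in_D_s[of q] by auto
    ultimately show ?thesis
      using P(1) by (simp add: D_s_at_closed)
  qed
  ultimately have "local_b_equation f p q"
    unfolding local_b_equation_def by metis
  moreover have "lead_coeff b = 1"
    using b by (simp add: is_local_b_function_def)
  then have "lead_coeff q = 1" "q \<noteq> 0"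
    unfolding q by (simp_all only: lead_coeff_mult) auto
  ultimately have "degree b \<le> degree q"
    using b by (simp add: is_local_b_function_def)
  moreover have "degree b = Suc (degree q)"
    using \<open>q \<noteq> 0\<close> unfolding q by (subst degree_mult_eq) auto
  ultimately show False by simp
qed

text \<open>
  The identity \<open>1 = e b - e q (s + a)\<close> and the functional equation express \<open>f\<^sup>s\<close> through
  \<open>f \<cdot> f\<^sup>s\<close> and \<open>(s + a) \<cdot> f\<^sup>s\<close> with local operators; \<open>h\<close> is their common denominator.
\<close>

lemma not_root_imp_nonvanishing:
  assumes G: "left_ideal_gen D_s G = ann_fs f" and b: "local_b_equation f p b"
    and ndvd: "\<not> [:a, 1:] dvd b"
  shows "\<exists>h. mp_eval h p \<noteq> 0 \<and>
    w_coef (of_cx h) \<in> left_ideal_gen D_s (G \<union> {w_coef (of_cx f), w_coef (of_cs [:a, 1:])})"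
proof -
  let ?I = "left_ideal_gen D_s (G \<union> {w_coef (of_cx f), w_coef (of_cs [:a, 1:])})"
  obtain P where P: "P \<in> D_s_at p" "fs_act f P (of_cx f) = of_cs b"
    using b by (auto simp: local_b_equation_def)
  obtain h where h: "mp_eval h p \<noteq> 0" "w_coef (of_cx h) * P \<in> D_s"
    using clear_denominators[OF P(1)] by blast
  \<comment> \<open>The remainder of \<open>b\<close> modulo \<open>s + a\<close> is a non-zero constant, hence invertible.\<close>
  define c where "c = poly b (- a)"
  have "c \<noteq> 0"
    using ndvd poly_eq_0_iff_dvd[of b "- a"] by (simp add: c_def)
  have "[:a, 1:] dvd b - [:c:]"
    using poly_eq_0_iff_dvd[of "b - [:c:]" "- a"] by (simp add: c_def)
  then obtain q where q: "b - [:c:] = [:a, 1:] * q"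
    by blast
  define e where "e = [:inverse c:]"
  have "e * [:c:] = 1"
    using \<open>c \<noteq> 0\<close> by (simp add: e_def one_pCons)
  moreover have "[:c:] = b - q * [:a, 1:]"
    using q by (simp only: algebra_simps)
  ultimately have bezout: "1 = e * (b - q * [:a, 1:])"
    by simp
  \<comment> \<open>Chosen so that \<open>A\<close> acts on \<open>f\<^sup>s\<close> as \<open>h - h (e b - e q (s + a)) = 0\<close>.\<close>
  define B where "B = w_coef (of_cs e) * (w_coef (of_cx h) * P)"
  define C where "C = w_coef (of_cs (- (e * q))) * w_coef (of_cx h)"
  define A where "A = w_coef (of_cx h) - (B * w_coef (of_cx f) + C * w_coef (of_cs [:a, 1:]))"
  have in_D: "B \<in> D_s" "C \<in> D_s"
    unfolding B_def C_def by (intro D_s_closed h(2) of_cs_in_D_s of_cx_in_D_s)+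
  have "fs_act f (B * w_coef (of_cx f) + C * w_coef (of_cs [:a, 1:])) 1
      = of_cs e * (of_cx h * of_cs b) + of_cs (- (e * q)) * of_cx h * of_cs [:a, 1:]"
    by (simp add: B_def C_def fs_act_add_left fs_act_mult fs_act_coef P(2) mult.assoc)
  also have "\<dots> = of_cx h * of_cs (e * b + - (e * q) * [:a, 1:])"
    unfolding of_cs_add of_cs_mult by (simp only: algebra_simps)
  also have "e * b + - (e * q) * [:a, 1:] = 1"
    using bezout by (simp only: right_diff_distrib mult.assoc mult_minus_left add_uminus_conv_diff)
  finally have "fs_act f A 1 = 0"
    by (simp add: A_def fs_act_diff_left fs_act_coef of_cs_1)
  then have "A \<in> ann_fs f"
    unfolding ann_fs_def A_def using in_D
    by (simp add: D_s_closed D_s_diff of_cs_in_D_s of_cx_in_D_s)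
  then have "A \<in> ?I"
    using G left_ideal_gen_mono[of G "G \<union> {w_coef (of_cx f), w_coef (of_cs [:a, 1:])}" D_s] by auto
  moreover have "w_coef (of_cx f) \<in> ?I" "w_coef (of_cs [:a, 1:]) \<in> ?I"
    using left_ideal_gen_superset[of "G \<union> {w_coef (of_cx f), w_coef (of_cs [:a, 1:])}" D_s] by auto
  ultimately have "A + (B * w_coef (of_cx f) + C * w_coef (of_cs [:a, 1:])) \<in> ?I"
    using in_D by (intro left_ideal_gen_add left_ideal_gen_mult)
  moreover have "A + (B * w_coef (of_cx f) + C * w_coef (of_cs [:a, 1:])) = w_coef (of_cx h)"
    by (simp add: A_def)
  ultimately show ?thesis
    using h(1) by auto
qed

theorem proposition2p17:
  fixes f :: "'n::{finite,linorder} mpoly" and p :: "complex ^ ('n::{finite,linorder})" and \<alpha> :: rat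
    and G :: "'n weyl set" and b :: "complex poly"
  assumes "f \<noteq> 0"
    and "finite G" and "left_ideal_gen D_s G = ann_fs f"
    and "is_local_b_function f p b"
  shows "[:of_rat \<alpha>, 1:] dvd b \<longleftrightarrow>
    p \<in> zero_set {g. w_coef (of_cx g) \<in>
      left_ideal_gen D_s (G \<union> {w_coef (of_cx f), w_coef (of_cs [:of_rat \<alpha>, 1:])})}"
proof -
  have "local_b_equation f p b"
    using assms(4) by (simp add: is_local_b_function_def)
  then show ?thesis
    using root_imp_vanishing[OF assms(3,4)] not_root_imp_nonvanishing[OF assms(3)]
    unfolding zero_set_def by blast
qed

end
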